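(* Let $A\in\mathbb{R}^{m\times n}$, $b\in\mathbb{R}^m$, $1\le s\le n$, and consider $\min\frac12\|Ax-b\|^2$ subject to $x\in\mathcal C=\{x\in\mathbb{R}^n:\|x\|_0\le s\}$. Let $x^*$ have exactly $s$ non-zero entries, let $S_{x^*}=[e_{i_1},\dots,e_{i_s}]\in\mathbb{R}^{n\times s}$ where $i_1<\dots<i_s$ are the indices of its non-zero entries, let $v^*=A^\top(Ax^*-b)$, and suppose $x^*$ is stationary, i.e. $(AS_{x^*})^\top(Ax^*-b)=0$. Let $x^*_{[s]}$ denote the $s$-th largest element in magnitude of $x^*$. If $(AS_{x^*})^\top AS_{x^*}$ has full rank and $$0<\eta<\min\Bigl\{\frac{2}{\|AS_{x^*}\|_2^2},\ \frac{|x^*_{[s]}|}{\|v^*\|_\infty}\Bigr\},$$ then projected gradient descent (iterative hard thresholding) with step size $\eta$ converges locally to $x^*$ at the asymptotic linear rate $$\rho=\max\{|1-\eta\lambda_1|,\ |1-\eta\lambda_s|\}<1,$$ where $\lambda_1$ and $\lambda_s$ are the largest and smallest eigenvalues of $(AS_{x^*})^\top AS_{x^*}$, with region of linear convergence $$\|x^{(0)}-x^*\|<\min\Bigl\{\frac{|x^*_{[s]}|}{\sqrt2},\ \frac{|x^*_{[s]}|-\eta\|v^*\|_\infty}{\sqrt2\,\|I_n-\eta A^\top A\|_2}\Bigr\}.$$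
   Context: $\|\cdot\|$ is the Euclidean norm, $\|\cdot\|_2$ the spectral norm, $\|x\|_0$ the number of non-zero entries of $x$, and $e_i$ the $i$-th standard basis vector. A quotient with zero denominator inside a minimum is read as $+\infty$. The projection $P_{\mathcal C}$ keeps the $s$ entries of $x$ largest in magnitude and sets the others to zero, with ties resolved by a fixed (lexicographic) rule. PGD: starting from $x^{(0)}\in\mathcal C$, $x^{(k+1)}=P_{\mathcal C}\bigl(x^{(k)}-\eta A^\top(Ax^{(k)}-b)\bigr)$ for $k\ge0$. Local convergence to $x^*$ at asymptotic linear rate $\rho$ with a given region means: $x^*=P_{\mathcal C}(x^*-\eta A^\top(Ax^*-b))$, and for every $x^{(0)}\in\mathcal C$ in the region the PGD iterates satisfy (when $\rho>0$): for any $0<\epsilon<1$, $\|x^{(k)}-x^*\|\le\epsilon\|x^{(0)}-x^*\|$ for all integers $k\ge\frac{\log(1/\epsilon)}{\log(1/\rho)}+c_3$, where $c_3>0$ is independent of $\epsilon$. Explicitly, $c_3$ is the value at $\tau=0$ (the projection has zero second-order error constants at $x^*$ and at $x^*-\eta v^*$) of $$c_3(\rho,\tau)=\frac{E_1\bigl(\log\frac{1}{\rho+\tau(1-\rho)}\bigr)-E_1\bigl(\log\frac1\rho\bigr)}{\rho\log(1/\rho)}+\frac{1}{2\rho}\log\Bigl(\frac{\log(1/\rho)}{\log\bigl(1/(\rho+\tau(1-\rho))\bigr)}\Bigr)+1,\qquad E_1(t)=\int_t^\infty\frac{e^{-z}}{z}\,dz,$$ that is, $c_3=1$. *)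

theory Defs
  imports "HOL-Analysis.Analysis"
begin

(* The coordinates of R^n are indexed by a finite linearly ordered type, the order playing
   the role of 1 < ... < n in the tie-breaking rule and in i_1 < ... < i_s. *)

definition supp :: "real^'n \<Rightarrow> 'n set" where
  "supp x = {i. x $ i \<noteq> 0}"

definition l0_norm :: "real^'n \<Rightarrow> nat" where
  "l0_norm x = card (supp x)"

definition sparse_set :: "nat \<Rightarrow> (real^'n) set" where
  "sparse_set s = {x. l0_norm x \<le> s}"

(* Strict total order on the coordinates: decreasing magnitude, ties broken in favour of the
   smaller index. *)
definition mag_before ::
  "real^('n::{finite,linorder}) \<Rightarrow> ('n::{finite,linorder}) \<Rightarrow> ('n::{finite,linorder}) \<Rightarrow> bool" where
  "mag_before x i j \<longleftrightarrow> \<bar>x $ j\<bar> < \<bar>x $ i\<bar> \<or> (\<bar>x $ i\<bar> = \<bar>x $ j\<bar> \<and> i < j)"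

definition sparse_proj :: "nat \<Rightarrow> real^('n::{finite,linorder}) \<Rightarrow> real^('n::{finite,linorder})" where
  "sparse_proj s x = (\<chi> i. if card {j. mag_before x j i} < s then x $ i else 0)"

(* Meaningful for 1 <= k <= n: the signed entry at position k of the order above. *)
definition kth_largest_mag :: "nat \<Rightarrow> real^('n::{finite,linorder}) \<Rightarrow> real" where
  "kth_largest_mag k x = x $ (THE i. card {j. mag_before x j i} = k - 1)"

definition least_squares_grad :: "real^'n^'m \<Rightarrow> real^'m \<Rightarrow> real^'n \<Rightarrow> real^'n" where
  "least_squares_grad A b x = transpose A *v (A *v x - b)"

definition pgd_step ::
  "real^('n::{finite,linorder})^'m \<Rightarrow> real^'m \<Rightarrow> nat \<Rightarrow> real \<Rightarrow> real^('n::{finite,linorder})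
    \<Rightarrow> real^('n::{finite,linorder})" where
  "pgd_step A b s \<eta> x = sparse_proj s (x - \<eta> *\<^sub>R least_squares_grad A b x)"

primrec pgd ::
  "real^('n::{finite,linorder})^'m \<Rightarrow> real^'m \<Rightarrow> nat \<Rightarrow> real \<Rightarrow> real^('n::{finite,linorder})
    \<Rightarrow> nat \<Rightarrow> real^('n::{finite,linorder})" where
  "pgd A b s \<eta> x0 0 = x0"
| "pgd A b s \<eta> x0 (Suc k) = pgd_step A b s \<eta> (pgd A b s \<eta> x0 k)"

definition pgd_converges_locally ::
  "real^('n::{finite,linorder})^'m \<Rightarrow> real^'m \<Rightarrow> nat \<Rightarrow> real \<Rightarrow> real^('n::{finite,linorder})
    \<Rightarrow> real
    \<Rightarrow> (real^('n::{finite,linorder})) set \<Rightarrow> real \<Rightarrow> bool" where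
  "pgd_converges_locally A b s \<eta> xs \<rho> R c \<longleftrightarrow>
     xs = pgd_step A b s \<eta> xs \<and>
     (\<rho> > 0 \<longrightarrow> c > 0 \<and>
       (\<forall>x0 \<in> sparse_set s \<inter> R. \<forall>\<epsilon>. 0 < \<epsilon> \<and> \<epsilon> < 1 \<longrightarrow>
         (\<forall>k::nat. real k \<ge> ln (1 / \<epsilon>) / ln (1 / \<rho>) + c \<longrightarrow>
           norm (pgd A b s \<eta> x0 k - xs) \<le> \<epsilon> * norm (x0 - xs))))"

definition expint_E1 :: "real \<Rightarrow> real" where
  "expint_E1 t = integral {t..} (\<lambda>z. exp (- z) / z)"

definition c3 :: "real \<Rightarrow> real \<Rightarrow> real" where
  "c3 \<rho> \<tau> =
     (expint_E1 (ln (1 / (\<rho> + \<tau> * (1 - \<rho>)))) - expint_E1 (ln (1 / \<rho>))) / (\<rho> * ln (1 / \<rho>))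
     + 1 / (2 * \<rho>) * ln (ln (1 / \<rho>) / ln (1 / (\<rho> + \<tau> * (1 - \<rho>)))) + 1"

lemma c3_zero: "0 < \<rho> \<Longrightarrow> \<rho> < 1 \<Longrightarrow> c3 \<rho> 0 = 1"
  by (simp add: c3_def)

definition column_selection :: "('s \<Rightarrow> 'n) \<Rightarrow> real^'s^'n" where
  "column_selection idx = (\<chi> i j. axis (idx j) 1 $ i)"

definition spectral_norm :: "real^'n^'m \<Rightarrow> real" where
  "spectral_norm M = onorm (\<lambda>x. M *v x)"

definition eigenvalues :: "real^'n^'n \<Rightarrow> real set" where
  "eigenvalues M = {l. \<exists>v. v \<noteq> 0 \<and> M *v v = l *\<^sub>R v}"

definition quotient_inf :: "real \<Rightarrow> real \<Rightarrow> ereal" where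
  "quotient_inf a d = (if d = 0 then \<infinity> else ereal (a / d))"

end

theory Submission
  imports Defs
begin

text \<open>
  The proof rests on the fact that, inside the region, every iterate has the same support
  \<open>S\<close> as \<open>x\<^sup>*\<close>, so that the projection acts as the linear coordinate restriction to \<open>S\<close> and
  projected gradient descent is plain gradient descent on the \<open>s\<close>-dimensional quadratic with
  Hessian \<open>H\<close>.

  Write \<open>m = |x\<^sup>*\<^bsub>[s]\<^esub>|\<close>, which is the smallest non-zero magnitude in \<open>x\<^sup>*\<close>
  (\<open>kth_largest_mag_full_support\<close>). By stationarity \<open>v\<^sup>*\<close> vanishes on \<open>S\<close>, so the exact gradient step
  \<open>z = x\<^sup>* - \<eta> v\<^sup>*\<close> has magnitudes at least \<open>m\<close> on \<open>S\<close> and at most \<open>\<eta> \<parallel>v\<^sup>*\<parallel>\<^sub>\<infinity> < m\<close> off \<open>S\<close>. A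
  perturbation of \<open>z\<close> can invert the order of an entry on \<open>S\<close> and one off \<open>S\<close> only if it changes the
  two entries together by at least the gap \<open>m - \<eta> \<parallel>v\<^sup>*\<parallel>\<^sub>\<infinity>\<close>, and two entries of a vector \<open>d\<close> sum to
  at most \<open>\<surd>2 \<parallel>d\<parallel>\<close>; hence the projection of any sufficiently close point still selects \<open>S\<close>
  (\<open>sparse_proj_near_gap\<close>). The gradient step from \<open>x\<close> differs from \<open>z\<close> by
  \<open>(I - \<eta> A\<^sup>T A) (x - x\<^sup>*)\<close>, which is where the second bound on the region comes from. The first bound
  makes the support of a sparse starting point equal to \<open>S\<close> (\<open>supp_eq_of_near_sparse\<close>).

  On \<open>S\<close> the error is therefore multiplied by \<open>I - \<eta> H\<close>, whose norm is at most \<open>\<rho>\<close> because a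
  symmetric matrix attains its norm at an eigenvalue (\<open>symmetric_norm_attained_at_eigenvalue\<close>,
  \<open>gradient_step_norm_le\<close>). Full rank and the step size put every \<open>\<eta> \<lambda>\<close> in \<open>(0, 2)\<close>, so \<open>\<rho> < 1\<close>; the
  error decreases, the iterates stay in the region, and after \<open>k\<close> steps the error is at most \<open>\<rho>\<^sup>k\<close>
  times the initial one.
\<close>

section \<open>Symmetric matrices\<close>

declare transpose_matrix_vector [simp del]

lemma adjoint_transpose:
  fixes M :: "real^'n^'m"
  shows "(transpose M *v x) \<bullet> y = x \<bullet> (M *v y)"
  by (simp add: transpose_matrix_vector dot_lmul_matrix)

text \<open>
  Eigenvectors of a symmetric matrix for distinct eigenvalues are orthogonal, hence independent.
  Finiteness is what makes the maximum and minimum of the spectrum genuine eigenvalues.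
\<close>

lemma finite_eigenvalues_symmetric:
  fixes M :: "real^'n^'n"
  assumes sym: "transpose M = M"
  shows "finite (eigenvalues M)"
proof -
  define w where "w l = (SOME u. u \<noteq> 0 \<and> M *v u = l *\<^sub>R u)" for l
  have w: "w l \<noteq> 0 \<and> M *v w l = l *\<^sub>R w l" if "l \<in> eigenvalues M" for l
    unfolding w_def by (rule someI_ex) (use that in \<open>simp add: eigenvalues_def\<close>)
  have orth: "w k \<bullet> w l = 0" if "k \<in> eigenvalues M" "l \<in> eigenvalues M" "k \<noteq> l" for k l
  proof -
    have "(M *v w k) \<bullet> w l = w k \<bullet> (M *v w l)"
      using adjoint_transpose[of M] by (simp add: sym)
    then have "(k - l) * (w k \<bullet> w l) = 0"
      using w[OF that(1)] w[OF that(2)] by (simp add: left_diff_distrib)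
    with \<open>k \<noteq> l\<close> show ?thesis by simp
  qed
  have inj: "inj_on w (eigenvalues M)"
    by (rule inj_onI) (metis orth w inner_eq_zero_iff)
  have "pairwise orthogonal (w ` eigenvalues M)"
    by (auto simp: pairwise_def orthogonal_def intro: orth)
  moreover have "0 \<notin> w ` eigenvalues M"
    using w by force
  ultimately have "finite (w ` eigenvalues M)"
    using independent_imp_finite pairwise_orthogonal_independent by blast
  then show ?thesis
    using finite_imageD inj by blast
qed

text \<open>
  The part of the spectral theorem needed here, obtained variationally: a unit vector \<open>x\<close>
  maximising \<open>\<sigma> = \<parallel>M x\<parallel>\<close> satisfies \<open>M\<^sup>2 x = \<sigma>\<^sup>2 x\<close>, since expanding \<open>\<parallel>M\<^sup>2 x - \<sigma>\<^sup>2 x\<parallel>\<^sup>2\<close> and using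
  \<open>\<parallel>M (M x)\<parallel> \<le> \<sigma> \<parallel>M x\<parallel>\<close> gives at most \<open>0\<close>. So \<open>\<sigma>\<close> or \<open>-\<sigma>\<close> is an eigenvalue.
\<close>

lemma symmetric_norm_attained_at_eigenvalue:
  fixes M :: "real^'n^'n"
  assumes sym: "transpose M = M"
  obtains l where "l \<in> eigenvalues M" and "\<And>x. norm (M *v x) \<le> \<bar>l\<bar> * norm x"
proof -
  have "continuous_on (sphere 0 1) (\<lambda>x. norm (M *v x))"
    by (intro continuous_intros matrix_vector_mult_linear_continuous_on)
  moreover have "sphere (0::real^'n) 1 \<noteq> {}"
    using vector_choose_size[of 1] by force
  ultimately obtain x where x: "x \<in> sphere 0 1"
    and max: "\<And>y. y \<in> sphere 0 1 \<Longrightarrow> norm (M *v y) \<le> norm (M *v x)"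
    using continuous_attains_sup[of "sphere 0 1" "\<lambda>x. norm (M *v x)"] by auto
  define \<sigma> where "\<sigma> = norm (M *v x)"
  have nx: "norm x = 1" using x by simp
  have bound: "norm (M *v y) \<le> \<sigma> * norm y" for y
  proof (cases "y = 0")
    case False
    have "norm (M *v (y /\<^sub>R norm y)) \<le> \<sigma>"
      unfolding \<sigma>_def by (rule max) (use False in simp)
    with False show ?thesis
      by (simp add: matrix_vector_mult_scaleR field_simps)
  qed simp
  have eq: "M *v (M *v x) = \<sigma>\<^sup>2 *\<^sub>R x"
  proof -
    have inner: "(M *v (M *v x)) \<bullet> x = \<sigma>\<^sup>2"
      using adjoint_transpose[of M "M *v x" x] by (simp add: sym \<sigma>_def power2_norm_eq_inner)
    have "norm (M *v (M *v x)) \<le> \<sigma> * \<sigma>"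
      using bound[of "M *v x"] by (simp add: \<sigma>_def)
    then have "(norm (M *v (M *v x)))\<^sup>2 \<le> (\<sigma> * \<sigma>)\<^sup>2"
      by (rule power_mono) simp
    then have sq: "(M *v (M *v x)) \<bullet> (M *v (M *v x)) \<le> \<sigma>\<^sup>2 * \<sigma>\<^sup>2"
      by (simp only: power2_norm_eq_inner) (simp add: power2_eq_square)
    have xx: "x \<bullet> x = 1" using nx by (simp add: dot_square_norm)
    define z where "z = M *v (M *v x)"
    have "(norm (z - \<sigma>\<^sup>2 *\<^sub>R x))\<^sup>2 = z \<bullet> z - 2 * \<sigma>\<^sup>2 * (z \<bullet> x) + \<sigma>\<^sup>2 * \<sigma>\<^sup>2 * (x \<bullet> x)"
      unfolding power2_norm_eq_inner
      by (simp add: inner_diff_left inner_diff_right inner_commute algebra_simps)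
    also have "\<dots> \<le> 0"
      using sq unfolding z_def inner xx by (simp add: mult.assoc)
    finally show ?thesis by (simp add: z_def)
  qed
  \<comment> \<open>Factor \<open>(M + \<sigma>) (M - \<sigma>) x = 0\<close>: one of the two factors produces an eigenvector.\<close>
  define y where "y = M *v x - \<sigma> *\<^sub>R x"
  have My: "M *v y = (- \<sigma>) *\<^sub>R y"
    by (simp add: y_def matrix_vector_mult_diff_distrib matrix_vector_mult_scaleR eq
        algebra_simps power2_eq_square)
  have "\<sigma> \<in> eigenvalues M \<or> - \<sigma> \<in> eigenvalues M"
  proof (cases "y = 0")
    case True
    then have "M *v x = \<sigma> *\<^sub>R x" by (simp add: y_def)
    moreover have "x \<noteq> 0" using nx by auto
    ultimately show ?thesis by (auto simp: eigenvalues_def)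
  next
    case False
    with My show ?thesis unfolding eigenvalues_def by blast
  qed
  moreover have "\<bar>\<sigma>\<bar> = \<sigma>" by (simp add: \<sigma>_def)
  ultimately show ?thesis
    using that[of \<sigma>] that[of "- \<sigma>"] bound by auto
qed

text \<open>
  For symmetric \<open>H\<close> the norm of \<open>I - \<eta> H\<close> is \<open>|1 - \<eta> \<lambda>|\<close> for some eigenvalue \<open>\<lambda>\<close> of \<open>H\<close>, and the convex function
  \<open>\<lambda> \<mapsto> |1 - \<eta> \<lambda>|\<close> is largest at an end of the spectrum.
\<close>

lemma gradient_step_norm_le:
  fixes H :: "real^'n^'n"
  assumes sym: "transpose H = H" and \<eta>: "\<eta> \<noteq> 0"
  shows "norm (u - \<eta> *\<^sub>R (H *v u))
    \<le> max \<bar>1 - \<eta> * Max (eigenvalues H)\<bar> \<bar>1 - \<eta> * Min (eigenvalues H)\<bar> * norm u"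
proof -
  define M where "M = mat 1 - \<eta> *\<^sub>R H"
  have Mu: "M *v u = u - \<eta> *\<^sub>R (H *v u)" for u
    by (simp add: M_def matrix_vector_mult_diff_rdistrib scaleR_matrix_vector_assoc)
  have "transpose M = M"
    using sym by (simp add: M_def transpose_def vec_eq_iff mat_def eq_commute)
  from symmetric_norm_attained_at_eigenvalue[OF this] obtain l
    where l: "l \<in> eigenvalues M" and bound: "\<And>x. norm (M *v x) \<le> \<bar>l\<bar> * norm x"
    by blast
  obtain w where w: "w \<noteq> 0" "M *v w = l *\<^sub>R w"
    using l by (auto simp: eigenvalues_def)
  define k where "k = (1 - l) / \<eta>"
  have "\<eta> *\<^sub>R (H *v w) = (1 - l) *\<^sub>R w"
    using w(2) unfolding Mu by (simp add: algebra_simps)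
  then have "H *v w = k *\<^sub>R w"
    unfolding k_def using \<eta>
    by (metis divide_inverse_commute scaleR_left_imp_eq scaleR_scaleR mult.commute
        nonzero_eq_divide_eq)
  with w(1) have k: "k \<in> eigenvalues H" by (auto simp: eigenvalues_def)
  have fin: "finite (eigenvalues H)" by (rule finite_eigenvalues_symmetric[OF sym])
  have kb: "Min (eigenvalues H) \<le> k" "k \<le> Max (eigenvalues H)"
    using fin k by simp_all
  have lk: "l = 1 - \<eta> * k" using \<eta> by (simp add: k_def)
  have "\<bar>l\<bar> \<le> max \<bar>1 - \<eta> * Max (eigenvalues H)\<bar> \<bar>1 - \<eta> * Min (eigenvalues H)\<bar>"
  proof (cases "\<eta> > 0")
    case True
    then have "\<eta> * Min (eigenvalues H) \<le> \<eta> * k" "\<eta> * k \<le> \<eta> * Max (eigenvalues H)"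
      using kb by simp_all
    then show ?thesis unfolding lk by linarith
  next
    case False
    then have "\<eta> * k \<le> \<eta> * Min (eigenvalues H)" "\<eta> * Max (eigenvalues H) \<le> \<eta> * k"
      using kb by (simp_all add: mult_left_mono_neg)
    then show ?thesis unfolding lk by linarith
  qed
  then show ?thesis
    using bound[of u] unfolding Mu by (meson mult_right_mono norm_ge_zero order_trans)
qed

lemma norm_matrix_vector_le_spectral_norm:
  fixes M :: "real^'n^'m"
  shows "norm (M *v x) \<le> spectral_norm M * norm x"
  unfolding spectral_norm_def
  by (rule onorm[OF matrix_vector_mul_bounded_linear])

text \<open>
  Pairing \<open>B\<^sup>T B w = \<lambda> w\<close> with \<open>w\<close> gives \<open>\<lambda> \<parallel>w\<parallel>\<^sup>2 = \<parallel>B w\<parallel>\<^sup>2\<close>; full rank excludes \<open>\<lambda> = 0\<close>.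
\<close>

lemma eigenvalues_gram_bounds:
  fixes B :: "real^'s^'m"
  assumes rk: "rank (transpose B ** B) = CARD('s)"
    and l: "l \<in> eigenvalues (transpose B ** B)"
  shows "0 < l" and "l \<le> (spectral_norm B)\<^sup>2"
proof -
  obtain w where w: "w \<noteq> 0" "(transpose B ** B) *v w = l *\<^sub>R w"
    using l by (auto simp: eigenvalues_def)
  have wp: "w \<bullet> w > 0" using w by simp
  have "l * (w \<bullet> w) = (transpose B *v (B *v w)) \<bullet> w"
    using w(2) by (simp add: matrix_vector_mul_assoc)
  also have "\<dots> = (norm (B *v w))\<^sup>2"
    by (simp only: adjoint_transpose power2_norm_eq_inner)
  finally have eq: "l * (w \<bullet> w) = (norm (B *v w))\<^sup>2" .
  have "inj ((*v) (transpose B ** B))"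
    using rk by (simp add: full_rank_injective)
  then have "l \<noteq> 0"
    using w by (metis injD matrix_vector_mult_0_right scaleR_zero_left)
  moreover have "0 \<le> l"
    using eq wp by (metis zero_le_mult_iff not_less zero_le_power2)
  ultimately show "0 < l" by simp
  have "(norm (B *v w))\<^sup>2 \<le> (spectral_norm B * norm w)\<^sup>2"
    by (intro power_mono norm_matrix_vector_le_spectral_norm) simp
  then have "l * (w \<bullet> w) \<le> (spectral_norm B)\<^sup>2 * (w \<bullet> w)"
    by (simp add: eq power_mult_distrib power2_norm_eq_inner)
  then show "l \<le> (spectral_norm B)\<^sup>2" using wp by simp
qed

lemma gradient_step_rate_less_1:
  fixes B :: "real^'s^'m"
  assumes H: "H = transpose B ** B" and rk: "rank H = CARD('s)"
    and \<eta>: "0 < \<eta>" "ereal \<eta> < quotient_inf 2 ((spectral_norm B)\<^sup>2)"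
  shows "max \<bar>1 - \<eta> * Max (eigenvalues H)\<bar> \<bar>1 - \<eta> * Min (eigenvalues H)\<bar> < 1"
proof -
  have sym: "transpose H = H" by (simp add: H matrix_transpose_mul)
  have ne: "eigenvalues H \<noteq> {}"
    using symmetric_norm_attained_at_eigenvalue[OF sym] by blast
  have fin: "finite (eigenvalues H)" by (rule finite_eigenvalues_symmetric[OF sym])
  have "\<bar>1 - \<eta> * l\<bar> < 1" if l: "l \<in> eigenvalues H" for l
  proof -
    have pos: "0 < l" and le: "l \<le> (spectral_norm B)\<^sup>2"
      using eigenvalues_gram_bounds[of B l] rk l by (simp_all add: H)
    then have "(spectral_norm B)\<^sup>2 > 0" by linarith
    with \<eta> have "\<eta> * (spectral_norm B)\<^sup>2 < 2"
      by (simp add: quotient_inf_def field_simps split: if_splits)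
    moreover have "\<eta> * l \<le> \<eta> * (spectral_norm B)\<^sup>2" "0 < \<eta> * l"
      using \<eta> pos le by simp_all
    ultimately show ?thesis by linarith
  qed
  with Max_in[OF fin ne] Min_in[OF fin ne] show ?thesis by simp
qed

section \<open>Coordinate subspaces\<close>

lemma transpose_column_selection_mult:
  "(transpose (column_selection idx) *v x) $ k = x $ idx k"
  by (simp add: column_selection_def transpose_def matrix_vector_mult_def axis_def
      if_distrib[of "\<lambda>c. c * _"] cong: if_cong)

lemma column_selection_mult_idx:
  assumes "inj idx"
  shows "(column_selection idx *v u) $ idx k = u $ k"
  using assms
  by (simp add: column_selection_def matrix_vector_mult_def axis_def inj_eq
      if_distrib[of "\<lambda>c. c * _"] cong: if_cong)

lemma column_selection_mult_outside:
  assumes "i \<notin> range idx"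
  shows "(column_selection idx *v u) $ i = 0"
proof -
  have "i \<noteq> idx j" for j using assms by auto
  then show ?thesis
    by (simp add: column_selection_def matrix_vector_mult_def axis_def)
qed

lemma norm_column_selection_mult:
  assumes "inj idx"
  shows "norm (column_selection idx *v u) = norm u"
proof -
  have "transpose (column_selection idx) *v (column_selection idx *v u) = u"
    by (simp add: vec_eq_iff transpose_column_selection_mult column_selection_mult_idx[OF assms])
  then have "(column_selection idx *v u) \<bullet> (column_selection idx *v u) = u \<bullet> u"
    by (metis adjoint_transpose)
  then show ?thesis by (simp add: norm_eq)
qed

lemma column_selection_supported:
  assumes "inj idx" and "supp d \<subseteq> range idx"
  shows "column_selection idx *v (transpose (column_selection idx) *v d) = d"
proof (rule vec_eq_iff[THEN iffD2, rule_format])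
  fix i
  show "(column_selection idx *v (transpose (column_selection idx) *v d)) $ i = d $ i"
  proof (cases "i \<in> range idx")
    case True
    then show ?thesis
      by (auto simp: column_selection_mult_idx[OF assms(1)] transpose_column_selection_mult)
  next
    case False
    then have "d $ i = 0" using assms(2) by (auto simp: supp_def)
    with False show ?thesis by (simp add: column_selection_mult_outside)
  qed
qed

section \<open>Hard thresholding\<close>

text \<open>
  The projection keeps an entry when fewer than \<open>card S\<close> entries precede it. If \<open>S\<close> strictly dominates,
  only other elements of \<open>S\<close> precede an element of \<open>S\<close>, while all of \<open>S\<close> precedes an element outside.
\<close>

lemma sparse_proj_dominant:
  fixes x :: "real^('n::{finite,linorder})"
  assumes dom: "\<And>i j. i \<in> S \<Longrightarrow> j \<notin> S \<Longrightarrow> \<bar>x $ j\<bar> < \<bar>x $ i\<bar>"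
  shows "sparse_proj (card S) x = (\<chi> i. if i \<in> S then x $ i else 0)"
proof -
  have "card {j. mag_before x j i} < card S" if "i \<in> S" for i
  proof (rule psubset_card_mono)
    have "{j. mag_before x j i} \<subseteq> S"
      using dom[OF that] by (force simp: mag_before_def)
    moreover have "i \<notin> {j. mag_before x j i}" by (simp add: mag_before_def)
    ultimately show "{j. mag_before x j i} \<subset> S" using that by blast
  qed simp
  moreover have "card S \<le> card {j. mag_before x j i}" if "i \<notin> S" for i
    by (rule card_mono) (use dom that in \<open>auto simp: mag_before_def\<close>)
  ultimately have "card {j. mag_before x j i} < card S \<longleftrightarrow> i \<in> S" for i
    by (meson not_less)
  then show ?thesis
    by (simp add: sparse_proj_def)
qed

lemma mag_before_rank_strict:
  assumes "mag_before x i j"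
  shows "card {k. mag_before x k i} < card {k. mag_before x k j}"
proof (rule psubset_card_mono)
  show "{k. mag_before x k i} \<subset> {k. mag_before x k j}"
    using assms by (auto simp: mag_before_def)
qed simp

text \<open>
  Strict totality of the order makes the number of predecessors an injection from the coordinates
  into \<open>{..<n}\<close>, hence a bijection, so the definite description is well defined.
\<close>

lemma kth_largest_mag_rank:
  fixes x :: "real^('n::{finite,linorder})"
  assumes "1 \<le> k" "k \<le> CARD('n)"
  obtains i where "kth_largest_mag k x = x $ i" and "card {j. mag_before x j i} = k - 1"
proof -
  define r where "r i = card {j. mag_before x j i}" for i
  have inj: "inj r"
  proof (rule injI)
    fix i j assume "r i = r j"
    then have "\<not> mag_before x i j" "\<not> mag_before x j i"
      using mag_before_rank_strict unfolding r_def by fastforce+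
    then show "i = j" by (auto simp: mag_before_def)
  qed
  have "r i < CARD('n)" for i
    unfolding r_def by (rule psubset_card_mono) (auto simp: mag_before_def)
  then have "range r = {..<CARD('n)}"
    by (intro card_subset_eq) (auto simp: card_image[OF inj])
  then have "k - 1 \<in> range r" using assms by auto
  then obtain i where i: "r i = k - 1" by auto
  then have "(THE i. r i = k - 1) = i"
    by (rule the_equality) (metis i inj injD)
  then show ?thesis using that[of i] i by (simp add: kth_largest_mag_def r_def)
qed

text \<open>
  The coordinate in position \<open>s\<close> has only \<open>s - 1\<close> predecessors, so it cannot lie behind the whole
  support; and a coordinate of the support behind it would have at least \<open>s\<close> predecessors, all of them
  among the other \<open>s - 1\<close> elements of the support.
\<close>

lemma kth_largest_mag_full_support:
  fixes x :: "real^('n::{finite,linorder})"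
  assumes s: "1 \<le> s" "card (supp x) = s"
  shows "0 < \<bar>kth_largest_mag s x\<bar>"
    and "\<And>i. i \<in> supp x \<Longrightarrow> \<bar>kth_largest_mag s x\<bar> \<le> \<bar>x $ i\<bar>"
proof -
  have "s \<le> CARD('n)" using s(2) by (metis card_mono finite subset_UNIV)
  then obtain i where i: "kth_largest_mag s x = x $ i" "card {j. mag_before x j i} = s - 1"
    using kth_largest_mag_rank s(1) by metis
  have "x $ i \<noteq> 0"
  proof
    assume "x $ i = 0"
    then have "supp x \<subseteq> {j. mag_before x j i}" by (auto simp: supp_def mag_before_def)
    then have "card (supp x) \<le> card {j. mag_before x j i}" by (intro card_mono) auto
    with i s show False by simp
  qed
  then show "0 < \<bar>kth_largest_mag s x\<bar>" by (simp add: i)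
  fix j assume j: "j \<in> supp x"
  show "\<bar>kth_largest_mag s x\<bar> \<le> \<bar>x $ j\<bar>"
  proof (rule ccontr)
    assume "\<not> ?thesis"
    then have "mag_before x i j" by (simp add: i mag_before_def)
    then have "s - 1 < card {k. mag_before x k j}"
      using mag_before_rank_strict i(2) by metis
    moreover have "{k. mag_before x k j} \<subset> supp x"
      using j by (auto simp: supp_def mag_before_def)
    then have "card {k. mag_before x k j} < s"
      using s(2) by (metis finite psubset_card_mono)
    ultimately show False by linarith
  qed
qed

lemma abs_component_sum_le:
  fixes d :: "real^'n"
  assumes "i \<noteq> j"
  shows "\<bar>d $ i\<bar> + \<bar>d $ j\<bar> \<le> sqrt 2 * norm d"
proof -
  have "(d $ i)\<^sup>2 + (d $ j)\<^sup>2 = (\<Sum>k\<in>{i, j}. (d $ k)\<^sup>2)"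
    using assms by simp
  also have "\<dots> \<le> (\<Sum>k\<in>UNIV. (d $ k)\<^sup>2)"
    by (rule sum_mono2) auto
  also have "\<dots> = (norm d)\<^sup>2"
    by (simp add: norm_vec_def L2_set_def sum_nonneg)
  finally have "(d $ i)\<^sup>2 + (d $ j)\<^sup>2 \<le> (norm d)\<^sup>2" .
  moreover have "(\<bar>d $ i\<bar> + \<bar>d $ j\<bar>)\<^sup>2 \<le> 2 * ((d $ i)\<^sup>2 + (d $ j)\<^sup>2)"
    using sum_squares_bound[of "\<bar>d $ i\<bar>" "\<bar>d $ j\<bar>"] by (simp add: power2_sum)
  ultimately have "(\<bar>d $ i\<bar> + \<bar>d $ j\<bar>)\<^sup>2 \<le> (sqrt 2 * norm d)\<^sup>2"
    by (simp add: power_mult_distrib)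
  then show ?thesis by (rule power2_le_imp_le) simp
qed

text \<open>
  The admissible error is the gap \<open>m - t\<close> divided by \<open>\<surd>2\<close>, and not by 2 or by a function of the
  dimension, because a swap in the order involves only two coordinates.
\<close>

lemma sparse_proj_near_gap:
  fixes y z :: "real^('n::{finite,linorder})"
  assumes large: "\<And>i. i \<in> S \<Longrightarrow> m \<le> \<bar>z $ i\<bar>"
    and small: "\<And>j. j \<notin> S \<Longrightarrow> \<bar>z $ j\<bar> \<le> t"
    and close: "sqrt 2 * norm (y - z) < m - t"
  shows "sparse_proj (card S) y = (\<chi> i. if i \<in> S then y $ i else 0)"
proof (rule sparse_proj_dominant)
  fix i j assume ij: "i \<in> S" "j \<notin> S"
  then have "\<bar>(y - z) $ i\<bar> + \<bar>(y - z) $ j\<bar> \<le> sqrt 2 * norm (y - z)"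
    by (intro abs_component_sum_le) auto
  with close large[OF ij(1)] small[OF ij(2)] show "\<bar>y $ j\<bar> < \<bar>y $ i\<bar>"
    by simp
qed

text \<open>
  Losing a coordinate of the support of \<open>z\<close> costs a distance of at least \<open>m\<close>, and once all are present
  sparsity leaves no room for another.
\<close>

lemma supp_eq_of_near_sparse:
  fixes x z :: "real^'n"
  assumes sparse: "card (supp x) \<le> card (supp z)"
    and large: "\<And>i. i \<in> supp z \<Longrightarrow> m \<le> \<bar>z $ i\<bar>"
    and close: "norm (x - z) < m"
  shows "supp x = supp z"
proof -
  have "x $ i \<noteq> 0" if "i \<in> supp z" for i
    using component_le_norm_cart[of "x - z" i] large[OF that] close by auto
  then have "supp z \<subseteq> supp x" by (auto simp: supp_def)
  with sparse show ?thesis by (metis card_seteq finite)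
qed

section \<open>Convergence\<close>

lemma power_le_of_log_bound:
  fixes \<rho> \<epsilon> :: real
  assumes \<rho>: "0 < \<rho>" "\<rho> < 1" and \<epsilon>: "0 < \<epsilon>"
    and k: "ln (1 / \<epsilon>) / ln (1 / \<rho>) \<le> real k"
  shows "\<rho> ^ k \<le> \<epsilon>"
proof -
  have "0 < ln (1 / \<rho>)" using \<rho> by simp
  then have "ln (1 / \<epsilon>) \<le> real k * ln (1 / \<rho>)"
    using k by (simp add: pos_divide_le_eq)
  then have "ln (\<rho> ^ k) \<le> ln \<epsilon>"
    using \<rho> \<epsilon> by (simp add: ln_realpow ln_div)
  with \<rho> \<epsilon> show ?thesis by simp
qed

theorem mainTheorem8:
  fixes A :: "real^('n::{finite,linorder})^('m::finite)"
    and b :: "real^('m::finite)"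
    and s :: nat
    and xs v :: "real^('n::{finite,linorder})"
    and idx :: "('s::{finite,linorder}) \<Rightarrow> ('n::{finite,linorder})"
    and AS :: "real^('s::{finite,linorder})^('m::finite)"
    and H :: "real^('s::{finite,linorder})^('s::{finite,linorder})"
    and \<eta> \<rho> :: real
  assumes "1 \<le> s" and "s \<le> CARD('n::{finite,linorder})"
    and "CARD('s::{finite,linorder}) = s"
    and "l0_norm xs = s"
    and "strict_mono idx" and "range idx = supp xs"
    and "AS = A ** column_selection idx"
    and "H = transpose AS ** AS"
    and "v = transpose A *v (A *v xs - b)"
    and "transpose AS *v (A *v xs - b) = 0"
    and "rank H = s"
    and "0 < \<eta>"
    and "ereal \<eta> < min (quotient_inf 2 ((spectral_norm AS)\<^sup>2))
                       (quotient_inf \<bar>kth_largest_mag s xs\<bar> (infnorm v))"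
    and "\<rho> = max \<bar>1 - \<eta> * Max (eigenvalues H)\<bar> \<bar>1 - \<eta> * Min (eigenvalues H)\<bar>"
  shows "\<rho> < 1 \<and>
    pgd_converges_locally A b s \<eta> xs \<rho>
      {x0. ereal (norm (x0 - xs)) <
           min (ereal (\<bar>kth_largest_mag s xs\<bar> / sqrt 2))
               (quotient_inf (\<bar>kth_largest_mag s xs\<bar> - \<eta> * infnorm v)
                  (sqrt 2 * spectral_norm (mat 1 - \<eta> *\<^sub>R (transpose A ** A))))}
      (c3 \<rho> 0)"
proof -
  define m where "m = \<bar>kth_largest_mag s xs\<bar>"
  define t where "t = \<eta> * infnorm v"
  define S where "S = supp xs"
  define P where "P = column_selection idx"
  define G where "G = mat 1 - \<eta> *\<^sub>R (transpose A ** A)"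
  define R where "R = {x0. ereal (norm (x0 - xs)) <
    min (ereal (m / sqrt 2)) (quotient_inf (m - t) (sqrt 2 * spectral_norm G))}"
  define z where "z = xs - \<eta> *\<^sub>R v"
  note \<eta> = \<open>0 < \<eta>\<close>
  have cardS: "card S = s" using assms(4) by (simp add: S_def l0_norm_def)
  have inj: "inj idx" using assms(5) by (rule strict_mono_imp_inj_on)
  have m: "0 < m" "\<And>i. i \<in> S \<Longrightarrow> m \<le> \<bar>xs $ i\<bar>"
    using kth_largest_mag_full_support[OF assms(1), of xs] cardS
    by (simp_all add: m_def S_def)
  have sym: "transpose H = H" by (simp add: assms(8) matrix_transpose_mul)
  have \<rho>1: "\<rho> < 1"
    unfolding assms(14) using assms
    by (intro gradient_step_rate_less_1[where B = AS]) auto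
  have \<rho>0: "0 \<le> \<rho>" by (simp add: assms(14))

  have gap: "t < m"
  proof (cases "infnorm v = 0")
    case True
    with m show ?thesis by (simp add: t_def)
  next
    case False
    then have "infnorm v > 0" by (simp add: infnorm_pos_le order_less_le)
    moreover have "ereal \<eta> < quotient_inf m (infnorm v)"
      using assms(13) by (simp add: m_def)
    ultimately show ?thesis by (simp add: quotient_inf_def t_def field_simps)
  qed

  have vS: "v $ i = 0" if "i \<in> S" for i
  proof -
    obtain k where k: "i = idx k" using \<open>i \<in> S\<close> assms(6) unfolding S_def by blast
    have "transpose P *v v = 0"
      using assms(10)
      by (simp add: assms(7,9) P_def matrix_transpose_mul matrix_vector_mul_assoc)
    then show ?thesis
      unfolding k P_def by (metis transpose_column_selection_mult zero_index)
  qed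
  have zS: "z $ i = xs $ i" if "i \<in> S" for i using vS[OF that] by (simp add: z_def)
  have z_large: "m \<le> \<bar>z $ i\<bar>" if "i \<in> S" for i using m(2)[OF that] zS[OF that] by simp
  have xs_out: "xs $ i = 0" if "i \<notin> S" for i using that by (simp add: S_def supp_def)
  have z_small: "\<bar>z $ j\<bar> \<le> t" if "j \<notin> S" for j
    using component_le_infnorm_cart[of v j] \<eta> xs_out[OF that]
    by (simp add: z_def t_def abs_mult)

  have fixed: "xs = pgd_step A b s \<eta> xs"
  proof -
    have "sparse_proj (card S) z = (\<chi> i. if i \<in> S then z $ i else 0)"
      using gap z_large z_small by (intro sparse_proj_near_gap[where m = m and t = t]) auto
    then show ?thesis
      unfolding pgd_step_def least_squares_grad_def assms(9)[symmetric] z_def[symmetric] cardS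
      by (simp add: vec_eq_iff zS xs_out)
  qed

  have step: "norm (pgd_step A b s \<eta> x - xs) \<le> \<rho> * norm (x - xs)
      \<and> supp (pgd_step A b s \<eta> x) \<subseteq> S"
    if xR: "x \<in> R" and xS: "supp x \<subseteq> S" for x
  proof -
    define d where "d = x - xs"
    define y where "y = x - \<eta> *\<^sub>R least_squares_grad A b x"
    have Gd: "G *v d = d - \<eta> *\<^sub>R (transpose A *v (A *v d))" for d
      by (simp add: G_def matrix_vector_mult_diff_rdistrib scaleR_matrix_vector_assoc
          matrix_vector_mul_assoc)
    have yz: "y - z = G *v d"
      by (simp add: Gd y_def z_def d_def assms(9) least_squares_grad_def
          matrix_vector_mult_diff_distrib algebra_simps)
    have small: "sqrt 2 * norm (y - z) < m - t"
    \<comment> \<open>When \<open>G = 0\<close> the quotient bounding the region is \<open>\<infinity>\<close>, but then the gradient step is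
      exactly \<open>z\<close>.\<close>
    proof (cases "spectral_norm G = 0")
      case True
      then have "norm (y - z) \<le> 0"
        using norm_matrix_vector_le_spectral_norm[of G d] by (simp add: yz)
      with gap show ?thesis by simp
    next
      case False
      then have pos: "spectral_norm G > 0"
        unfolding spectral_norm_def
        by (metis matrix_vector_mul_bounded_linear onorm_pos_le order_less_le)
      with xR have "norm d * (sqrt 2 * spectral_norm G) < m - t"
        by (simp add: R_def quotient_inf_def d_def pos_less_divide_eq)
      moreover have "norm (y - z) * sqrt 2 \<le> (spectral_norm G * norm d) * sqrt 2"
        unfolding yz by (intro mult_right_mono norm_matrix_vector_le_spectral_norm) simp
      ultimately show ?thesis by (simp only: mult_ac)
    qed
    have proj: "pgd_step A b s \<eta> x = (\<chi> i. if i \<in> S then y $ i else 0)"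
      using sparse_proj_near_gap[of S m z t y, OF z_large z_small small]
      by (simp add: pgd_step_def y_def cardS)
    define u where "u = transpose P *v d"
    have "supp d \<subseteq> range idx"
      using xS xs_out unfolding assms(6) S_def[symmetric] by (auto simp: supp_def d_def)
    then have Pu: "P *v u = d"
      unfolding u_def P_def by (rule column_selection_supported[OF inj])
    \<comment> \<open>Restricted to \<open>S\<close>, the matrix \<open>I - \<eta> A\<^sup>T A\<close> becomes \<open>I - \<eta> H\<close>.\<close>
    have restrict: "transpose P *v (y - z) = u - \<eta> *\<^sub>R (H *v u)"
    proof -
      have "H *v u = transpose P *v (transpose A *v (A *v d))"
        by (simp add: assms(7,8) P_def[symmetric] matrix_transpose_mul Pu[symmetric]
            matrix_vector_mul_assoc matrix_mul_assoc)
      then show ?thesis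
        by (simp add: yz Gd u_def matrix_vector_mult_diff_distrib matrix_vector_mult_scaleR)
    qed
    have "pgd_step A b s \<eta> x - xs = P *v (u - \<eta> *\<^sub>R (H *v u))"
    proof (rule vec_eq_iff[THEN iffD2, rule_format])
      fix i
      show "(pgd_step A b s \<eta> x - xs) $ i = (P *v (u - \<eta> *\<^sub>R (H *v u))) $ i"
      proof (cases "i \<in> S")
        case True
        then obtain k where k: "i = idx k" using assms(6) unfolding S_def by blast
        show ?thesis
          using True unfolding restrict[symmetric] P_def k
          by (simp add: column_selection_mult_idx[OF inj] transpose_column_selection_mult
              proj zS)
      next
        case False
        then show ?thesis
          using assms(6) by (simp add: P_def column_selection_mult_outside proj xs_out S_def)
      qed
    qed
    then have "norm (pgd_step A b s \<eta> x - xs) = norm (u - \<eta> *\<^sub>R (H *v u))"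
      unfolding P_def by (simp only: norm_column_selection_mult[OF inj])
    also have "\<dots> \<le> \<rho> * norm u"
      unfolding assms(14) using \<eta> by (intro gradient_step_norm_le sym) simp
    also have "norm u = norm d"
      unfolding Pu[symmetric] P_def by (rule norm_column_selection_mult[OF inj, symmetric])
    finally show ?thesis by (auto simp: d_def proj supp_def)
  qed

  have iter: "norm (pgd A b s \<eta> x0 k - xs) \<le> \<rho> ^ k * norm (x0 - xs)
      \<and> supp (pgd A b s \<eta> x0 k) \<subseteq> S"
    if x0: "x0 \<in> R" "x0 \<in> sparse_set s" for x0 k
  proof (induction k)
    case 0
    have "m / sqrt 2 \<le> m" using m(1) by (simp add: field_simps)
    then have "norm (x0 - xs) < m" using x0(1) by (simp add: R_def)
    then have "supp x0 = S"
      using x0(2) m(2) cardS unfolding S_def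
      by (intro supp_eq_of_near_sparse) (auto simp: sparse_set_def l0_norm_def)
    then show ?case by simp
  next
    case (Suc k)
    define x where "x = pgd A b s \<eta> x0 k"
    have "\<rho> ^ k * norm (x0 - xs) \<le> 1 * norm (x0 - xs)"
      using \<rho>0 \<rho>1 by (intro mult_right_mono power_le_one) auto
    then have "ereal (norm (x - xs)) \<le> ereal (norm (x0 - xs))"
      using Suc unfolding x_def ereal_less_eq by linarith
    also have "\<dots> < min (ereal (m / sqrt 2)) (quotient_inf (m - t) (sqrt 2 * spectral_norm G))"
      using x0(1) unfolding R_def by blast
    finally have "x \<in> R" unfolding R_def by blast
    then have "norm (pgd_step A b s \<eta> x - xs) \<le> \<rho> * norm (x - xs)
        \<and> supp (pgd_step A b s \<eta> x) \<subseteq> S"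
      using step Suc unfolding x_def by blast
    moreover have "\<rho> * norm (x - xs) \<le> \<rho> * (\<rho> ^ k * norm (x0 - xs))"
      using Suc \<rho>0 unfolding x_def by (intro mult_left_mono) auto
    ultimately show ?case by (simp add: x_def mult.assoc)
  qed

  have "norm (pgd A b s \<eta> x0 k - xs) \<le> \<epsilon> * norm (x0 - xs)"
    if "0 < \<rho>" "x0 \<in> sparse_set s \<inter> R" "0 < \<epsilon>"
      "ln (1 / \<epsilon>) / ln (1 / \<rho>) + 1 \<le> real k" for x0 \<epsilon> k
  proof -
    have "\<rho> ^ k \<le> \<epsilon>"
      using that \<rho>1 by (intro power_le_of_log_bound) auto
    then have "\<rho> ^ k * norm (x0 - xs) \<le> \<epsilon> * norm (x0 - xs)"
      by (rule mult_right_mono) simp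
    with iter[of x0 k] that(2) show ?thesis by auto
  qed
  then have "pgd_converges_locally A b s \<eta> xs \<rho> R (c3 \<rho> 0)"
    unfolding pgd_converges_locally_def using fixed \<rho>1 by (auto simp: c3_zero)
  with \<rho>1 show ?thesis by (simp add: R_def m_def t_def G_def)
qed

end
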